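(* Let $d$ be a positive integer and $\chi$ a primitive Dirichlet character of conductor $d$. Let $w_1,w_2,w_3$ be any positive integers, $y_1\in\mathbb{Z}_p$, and $n\ge0$ an integer. Then \begin{align*} &\sum_{k+l+m=n}\binom{n}{k,l,m}B_{k,\chi}(w_{1}y_{1})S_{l}(w_{2}d-1,\chi)S_{m}(w_{3}d-1,\chi)w_{1}^{l+m}w_{2}^{k+m-1}w_{3}^{k+l-1}\\ =&\sum_{k+l+m=n}\binom{n}{k,l,m}B_{k,\chi}(w_{2}y_{1})S_{l}(w_{3}d-1,\chi)S_{m}(w_{1}d-1,\chi)w_{2}^{l+m}w_{3}^{k+m-1}w_{1}^{k+l-1}\\ =&\sum_{k+l+m=n}\binom{n}{k,l,m}B_{k,\chi}(w_{3}y_{1})S_{l}(w_{1}d-1,\chi)S_{m}(w_{2}d-1,\chi)w_{3}^{l+m}w_{1}^{k+m-1}w_{2}^{k+l-1}. \end{align*}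
   Context: $p$ is a fixed prime, $\mathbb{Z}_p$ the $p$-adic integers; algebraic numbers are viewed in $\mathbb{C}_p$ via a fixed embedding $\overline{\mathbb{Q}}\to\mathbb{C}_p$. The character $\chi$ is regarded as a function on integers (periodic mod $d$, with $\chi(a)=0$ when $\gcd(a,d)>1$; for $d=1$, $\chi\equiv 1$). The generalized Bernoulli polynomials are defined by $\frac{te^{xt}}{e^{dt}-1}\sum_{a=0}^{d-1}\chi(a)e^{at}=\sum_{n\ge0}B_{n,\chi}(x)\frac{t^n}{n!}$. The generalized power sum is $S_k(N,\chi)=\sum_{a=0}^{N}\chi(a)a^k$ (with $0^0=1$). Sums are over nonnegative integers $k,l,m$ with $k+l+m=n$, and $\binom{n}{k,l,m}=\frac{n!}{k!l!m!}$. *)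

theory Defs
  imports
    Complex_Main
    "HOL-Computational_Algebra.Computational_Algebra"
    "HOL-Number_Theory.Cong"
begin

subsection \<open>The fields of p-adic and of complex p-adic numbers\<close>

definition padic_abs_rat :: "nat \<Rightarrow> rat \<Rightarrow> real" where
  "padic_abs_rat p q =
     (if q = 0 then 0
      else real p powi (int (multiplicity (int p) (snd (quotient_of q))) -
                        int (multiplicity (int p) (fst (quotient_of q)))))"

text \<open>
  In the following three definitions \<open>v\<close> is an absolute value on a field for which the field is
  complete, so the closure of the rationals is a completion of the rationals.
\<close>

definition Qp_in :: "('c :: field_char_0 \<Rightarrow> real) \<Rightarrow> 'c set" where
  "Qp_in v = {x. \<forall>e>0. \<exists>q. v (x - of_rat q) < e}"

definition Zp_in :: "('c :: field_char_0 \<Rightarrow> real) \<Rightarrow> 'c set" where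
  "Zp_in v = {x \<in> Qp_in v. v x \<le> 1}"

definition Qp_algebraic_in :: "('c :: field_char_0 \<Rightarrow> real) \<Rightarrow> 'c set" where
  "Qp_algebraic_in v = {x. \<exists>f. f \<noteq> 0 \<and> (\<forall>i. coeff f i \<in> Qp_in v) \<and> poly f x = 0}"

text \<open>
  The field \<open>'c\<close> with the absolute value \<open>v\<close> is a completion of an algebraic closure of the
  completion of the rationals with respect to the p-adic absolute value. This determines
  \<open>'c\<close> and \<open>v\<close> up to isometric isomorphism.
\<close>

locale complex_padic_field =
  fixes p :: nat and v :: "'c :: field_char_0 \<Rightarrow> real"
  assumes prime_p: "prime p"
    and v_nonneg: "v x \<ge> 0"
    and v_eq_0_iff: "v x = 0 \<longleftrightarrow> x = 0"
    and v_mult: "v (x * y) = v x * v y"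
    and v_add: "v (x + y) \<le> max (v x) (v y)"
    and v_of_rat: "v (of_rat q) = padic_abs_rat p q"
    and v_complete:
      "(\<forall>e>0. \<exists>N. \<forall>i\<ge>N. \<forall>j\<ge>N. v (X i - X j) < e) \<Longrightarrow>
         \<exists>x. (\<lambda>i::nat. v (X i - x)) \<longlonglongrightarrow> 0"
    and Qp_algebraic_closed:
      "\<lbrakk>degree f > 0; \<forall>i. coeff f i \<in> Qp_algebraic_in v\<rbrakk> \<Longrightarrow>
         \<exists>x\<in>Qp_algebraic_in v. poly f x = 0"
    and Qp_algebraic_dense: "e > 0 \<Longrightarrow> \<exists>a\<in>Qp_algebraic_in v. v (x - a) < e"

text \<open>
  The algebraic numbers are those in the complex numbers. An embedding is only constrained on
  algebraic numbers; its values elsewhere are irrelevant.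
\<close>

definition algebraic_embedding :: "(complex \<Rightarrow> 'c :: field_char_0) \<Rightarrow> bool" where
  "algebraic_embedding \<iota> \<longleftrightarrow>
     \<iota> 1 = 1 \<and>
     (\<forall>x y. algebraic x \<longrightarrow> algebraic y \<longrightarrow> \<iota> (x + y) = \<iota> x + \<iota> y \<and> \<iota> (x * y) = \<iota> x * \<iota> y) \<and>
     inj_on \<iota> {x. algebraic x}"


subsection \<open>Dirichlet characters\<close>

definition dirichlet_character :: "nat \<Rightarrow> (int \<Rightarrow> complex) \<Rightarrow> bool" where
  "dirichlet_character d \<chi> \<longleftrightarrow>
     d > 0 \<and>
     (\<forall>a b. [a = b] (mod int d) \<longrightarrow> \<chi> a = \<chi> b) \<and>
     (\<forall>a b. \<chi> (a * b) = \<chi> a * \<chi> b) \<and>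
     (\<forall>a. \<chi> a \<noteq> 0 \<longleftrightarrow> coprime a (int d))"

text \<open>
  The conductor is the least divisor \<open>m\<close> of \<open>d\<close> such that the character factors through the
  units modulo \<open>m\<close>.
\<close>

definition dirichlet_conductor :: "nat \<Rightarrow> (int \<Rightarrow> complex) \<Rightarrow> nat" where
  "dirichlet_conductor d \<chi> =
     (LEAST m. m dvd d \<and> (\<forall>a. coprime a (int d) \<and> [a = 1] (mod int m) \<longrightarrow> \<chi> a = 1))"

definition primitive_dirichlet_character :: "nat \<Rightarrow> (int \<Rightarrow> complex) \<Rightarrow> bool" where
  "primitive_dirichlet_character d \<chi> \<longleftrightarrow>
     dirichlet_character d \<chi> \<and> dirichlet_conductor d \<chi> = d"


subsection \<open>Generalized Bernoulli polynomials and power sums\<close>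

definition gen_bernoulli_fps :: "nat \<Rightarrow> (int \<Rightarrow> 'c :: field_char_0) \<Rightarrow> 'c \<Rightarrow> 'c fps" where
  "gen_bernoulli_fps d \<chi> x =
     fps_X * fps_exp x * (\<Sum>a<d. fps_const (\<chi> (int a)) * fps_exp (of_nat a)) /
       (fps_exp (of_nat d) - 1)"

definition gen_bernpoly :: "nat \<Rightarrow> (int \<Rightarrow> 'c :: field_char_0) \<Rightarrow> nat \<Rightarrow> 'c \<Rightarrow> 'c" where
  "gen_bernpoly d \<chi> n x = fact n * fps_nth (gen_bernoulli_fps d \<chi> x) n"

text \<open>
  The denominator has subdegree 1, and the factor \<open>fps_X\<close> makes the quotient exact.
\<close>

lemma gen_bernoulli_fps_mult:
  fixes x :: "'c :: field_char_0"
  assumes "d > 0"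
  shows "gen_bernoulli_fps d \<chi> x * (fps_exp (of_nat d) - 1) =
           fps_X * fps_exp x * (\<Sum>a<d. fps_const (\<chi> (int a)) * fps_exp (of_nat a))"
proof -
  let ?D = "fps_exp (of_nat d :: 'c) - 1"
  have sd: "subdegree ?D = 1"
    using assms by (intro subdegreeI) auto
  have "?D dvd fps_X"
    using sd assms by (subst fps_dvd_iff) auto
  thus ?thesis
    unfolding gen_bernoulli_fps_def by (intro dvd_div_mult_self dvd_mult2)
qed

lemma gen_bernoulli_fps_conv_gen_bernpoly:
  "gen_bernoulli_fps d \<chi> x = Abs_fps (\<lambda>n. gen_bernpoly d \<chi> n x / fact n)"
  by (rule fps_ext) (simp add: gen_bernpoly_def)

definition gen_power_sum :: "nat \<Rightarrow> nat \<Rightarrow> (int \<Rightarrow> 'c :: field_char_0) \<Rightarrow> 'c" where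
  "gen_power_sum k N \<chi> = (\<Sum>a=0..N. \<chi> (int a) * of_nat a ^ k)"

definition trinomial :: "nat \<Rightarrow> nat \<Rightarrow> nat \<Rightarrow> nat \<Rightarrow> 'c :: field_char_0" where
  "trinomial n k l m = fact n / (fact k * fact l * fact m)"

end

(*
  Scaling t by w2 w3, w1 w3 and w1 w2, the exponential generating function of the first sum is
    t e^(w1 w2 w3 y t) (e^(w1 w2 w3 d t) - 1)^2 A(w2 w3 t) A(w1 w3 t) A(w1 w2 t)
      / ((e^(w2 w3 d t) - 1) (e^(w1 w3 d t) - 1) (e^(w1 w2 d t) - 1)),
  where A(t) is the sum of chi(a) e^(a t) over a < d, because the geometric series and the
  periodicity of chi turn the generating function of S_k(w d - 1, chi) into
  A(t) (e^(w d t) - 1) / (e^(d t) - 1). This expression is symmetric in w1, w2 and w3.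
*)

theory Submission
  imports Defs
begin

text \<open>For \<open>N = d\<close> this is the series A(t) of the idea above; for
  \<open>N = w * d\<close> it is the exponential generating function of the power sums up to
  \<open>w * d - 1\<close>.\<close>

definition char_exp_sum :: "nat \<Rightarrow> (int \<Rightarrow> 'c :: field_char_0) \<Rightarrow> 'c fps" where
  "char_exp_sum N f = (\<Sum>a<N. fps_const (f (int a)) * fps_exp (of_nat a))"

abbreviation fps_scale :: "'c :: field_char_0 \<Rightarrow> 'c fps \<Rightarrow> 'c fps" where
  "fps_scale c F \<equiv> F oo (fps_const c * fps_X)"

lemma fps_scale_mult: "fps_scale c (F * G) = fps_scale c F * fps_scale c G"
  by (simp add: fps_compose_mult_distrib)

lemma fps_scale_exp_minus_1: "fps_scale c (fps_exp a - 1) = fps_exp (c * a) - 1"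
  by (simp add: fps_compose_sub_distrib)

lemma fps_nth_fps_scale: "fps_nth (fps_scale c F) n = c ^ n * fps_nth F n"
  by (simp add: fps_compose_linear)

lemma fps_exp_minus_1_nonzero:
  fixes a :: "'c :: field_char_0"
  assumes "a \<noteq> 0"
  shows "fps_exp a - 1 \<noteq> 0"
proof
  assume "fps_exp a - 1 = 0"
  then have "fps_nth (fps_exp a - 1) 1 = 0" by simp
  with assms show False by simp
qed

lemma fps_nth_mult3:
  fixes F G H :: "'a :: comm_semiring_1 fps"
  shows "fps_nth (F * G * H) n =
    (\<Sum>(k, l, m) \<in> {(k, l, m). k + l + m = n}. fps_nth F k * fps_nth G l * fps_nth H m)"
proof -
  have "fps_nth (F * G * H) n =
      (\<Sum>(i, j) \<in> (SIGMA i:{0..n}. {0..i}).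
         fps_nth F j * fps_nth G (i - j) * fps_nth H (n - i))"
    by (simp add: fps_mult_nth sum_distrib_right sum.Sigma)
  also have "\<dots> =
      (\<Sum>(k, l, m) \<in> {(k, l, m). k + l + m = n}. fps_nth F k * fps_nth G l * fps_nth H m)"
    \<comment> \<open>Here \<open>i\<close> is the degree contributed by \<open>F * G\<close> and
      \<open>j\<close> the degree contributed by \<open>F\<close>.\<close>
    by (rule sum.reindex_bij_witness[of _ "\<lambda>(k, l, m). (k + l, k)" "\<lambda>(i, j). (j, i - j, n - i)"])
       auto
  finally show ?thesis .
qed

lemma fps_nth_char_exp_sum:
  assumes "N > 0"
  shows "fps_nth (char_exp_sum N f) k = gen_power_sum k (N - 1) f / fact k"
proof -
  \<comment> \<open>Truncated subtraction makes this fail at \<open>N = 0\<close>, where the left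
    side is {0}.\<close>
  have "{0..N - 1} = {..<N}" using assms by auto
  then show ?thesis
    by (simp add: char_exp_sum_def gen_power_sum_def fps_sum_nth sum_divide_distrib)
qed

lemma periodic_add_multiple:
  assumes "\<And>a :: int. f (a + int d) = f a"
  shows "f (int (w * d) + a) = f a"
proof (induction w)
  case (Suc w)
  have "int (Suc w * d) + a = (int (w * d) + a) + int d" by simp
  then show ?case using assms Suc by metis
qed simp

lemma sum_lessThan_add:
  fixes g :: "nat \<Rightarrow> 'a :: comm_monoid_add"
  shows "sum g {..<m + n} = sum g {..<m} + (\<Sum>a<n. g (m + a))"
  by (induction n) (simp_all add: add_ac)

text \<open>The geometric series in cleared form, since \<open>fps_exp (of_nat d) - 1\<close> has
  zero constant term and is no unit. By periodicity the last block of \<open>d\<close> terms is e^(w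
  d t) A(t), and e^(w d t) (e^(d t) - 1) is exactly the increment of e^(w d t) - 1 when
  \<open>w\<close> grows by one.\<close>

lemma char_exp_sum_mult_period:
  fixes f :: "int \<Rightarrow> 'c :: field_char_0"
  assumes "\<And>a. f (a + int d) = f a"
  shows "char_exp_sum (w * d) f * (fps_exp (of_nat d) - 1) =
    char_exp_sum d f * (fps_exp (of_nat (w * d)) - 1)"
proof (induction w)
  case 0
  then show ?case by (simp add: char_exp_sum_def)
next
  case (Suc w)
  have "char_exp_sum (w * d + d) f = char_exp_sum (w * d) f +
      (\<Sum>a<d. fps_const (f (int (w * d + a))) * fps_exp (of_nat (w * d + a)))"
    unfolding char_exp_sum_def by (rule sum_lessThan_add)
  also have "(\<Sum>a<d. fps_const (f (int (w * d + a))) * fps_exp (of_nat (w * d + a))) =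
      fps_exp (of_nat (w * d)) * char_exp_sum d f"
    unfolding char_exp_sum_def sum_distrib_left of_nat_add fps_exp_add_mult
      periodic_add_multiple[of f, OF assms]
    by (simp add: mult_ac)
  finally have "char_exp_sum (w * d + d) f =
      char_exp_sum (w * d) f + fps_exp (of_nat (w * d)) * char_exp_sum d f" .
  moreover have "fps_exp (of_nat (w * d + d) :: 'c) =
      fps_exp (of_nat (w * d)) * fps_exp (of_nat d)"
    by (simp only: of_nat_add fps_exp_add_mult)
  moreover have "Suc w * d = w * d + d" by simp
  ultimately show ?case
    using Suc by (simp only:) (simp add: algebra_simps)
qed

text \<open>The three sums of the theorem are the cyclic rotations of \<open>u\<close>,
  \<open>v\<close>, \<open>w\<close>. Integer powers are needed because an exponent is -1 when its
  two indices vanish.\<close>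

definition triple_sum ::
  "nat \<Rightarrow> (int \<Rightarrow> 'c :: field_char_0) \<Rightarrow> 'c \<Rightarrow> nat \<Rightarrow> nat \<Rightarrow> nat \<Rightarrow> nat \<Rightarrow> 'c" where
  "triple_sum d f y n u v w = (\<Sum>(k, l, m) \<in> {(k, l, m). k + l + m = n}.
     trinomial n k l m *
     gen_bernpoly d f k (of_nat u * y) *
     gen_power_sum l (v * d - 1) f *
     gen_power_sum m (w * d - 1) f *
     of_nat u ^ (l + m) *
     of_nat v powi (int k + int m - 1) *
     of_nat w powi (int k + int l - 1))"

text \<open>The scalings contribute (v w)^k (u w)^l (u v)^m = u^(l+m) v^(k+m) w^(k+l). Compared with
  \<open>triple_sum\<close>, only the two exponents -1 are missing; they become a division by
  \<open>v * w\<close> of the whole coefficient.\<close>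

definition triple_fps ::
  "nat \<Rightarrow> (int \<Rightarrow> 'c :: field_char_0) \<Rightarrow> 'c \<Rightarrow> nat \<Rightarrow> nat \<Rightarrow> nat \<Rightarrow> 'c fps" where
  "triple_fps d f y u v w =
     fps_scale (of_nat (v * w)) (gen_bernoulli_fps d f (of_nat u * y)) *
     fps_scale (of_nat (u * w)) (char_exp_sum (v * d) f) *
     fps_scale (of_nat (u * v)) (char_exp_sum (w * d) f)"

lemma powi_add_minus_1:
  fixes x :: "'a :: field"
  assumes "x \<noteq> 0"
  shows "x powi (int i + int j - 1) = x ^ i * x ^ j / x"
  using assms by (simp add: power_int_diff power_int_add)

lemma triple_sum_conv_fps_nth:
  fixes f :: "int \<Rightarrow> 'c :: field_char_0"
  assumes "d > 0" "u > 0" "v > 0" "w > 0"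
  shows "triple_sum d f y n u v w =
    fact n * fps_nth (triple_fps d f y u v w) n / of_nat (v * w)"
  unfolding triple_sum_def triple_fps_def fps_nth_mult3 sum_distrib_left sum_divide_distrib
proof (rule sum.cong[OF refl], clarify)
  fix k l m :: nat
  have nz: "(of_nat v :: 'c) \<noteq> 0" "(of_nat w :: 'c) \<noteq> 0" and pos: "v * d > 0" "w * d > 0"
    using assms by auto
  show "trinomial (k + l + m) k l m * gen_bernpoly d f k (of_nat u * y) *
      gen_power_sum l (v * d - 1) f * gen_power_sum m (w * d - 1) f * of_nat u ^ (l + m) *
      of_nat v powi (int k + int m - 1) * of_nat w powi (int k + int l - 1) =
    fact (k + l + m) *
      (fps_nth (fps_scale (of_nat (v * w)) (gen_bernoulli_fps d f (of_nat u * y))) k *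
       fps_nth (fps_scale (of_nat (u * w)) (char_exp_sum (v * d) f)) l *
       fps_nth (fps_scale (of_nat (u * v)) (char_exp_sum (w * d) f)) m) / of_nat (v * w)"
    unfolding fps_nth_fps_scale fps_nth_char_exp_sum[OF pos(1)] fps_nth_char_exp_sum[OF pos(2)]
      powi_add_minus_1[OF nz(1)] powi_add_minus_1[OF nz(2)] trinomial_def gen_bernpoly_def
    using nz by (simp add: power_add power_mult_distrib mult_ac)
qed

text \<open>Apart from the constant \<open>v * w\<close>, the right-hand side is symmetric in
  \<open>u\<close>, \<open>v\<close>, \<open>w\<close>. That constant comes from scaling the factor
  \<open>fps_X\<close> of the Bernoulli series and matches the division by \<open>v * w\<close> in
  \<open>triple_sum_conv_fps_nth\<close>.\<close>

lemma triple_fps_mult_denominators: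
  fixes f :: "int \<Rightarrow> 'c :: field_char_0" and u v w d :: nat
  defines "E \<equiv> \<lambda>j. fps_exp (of_nat (j * d)) - 1 :: 'c fps"
  defines "A \<equiv> \<lambda>j. fps_scale (of_nat j) (char_exp_sum d f)"
  assumes "d > 0" and per: "\<And>a. f (a + int d) = f a"
  shows "triple_fps d f y u v w * (E (v * w) * E (u * w) * E (u * v)) =
    fps_const (of_nat (v * w)) * (fps_X * fps_exp (of_nat (u * v * w) * y) * E (u * v * w) ^ 2 *
      (A (v * w) * A (u * w) * A (u * v)))"
proof -
  \<comment> \<open>Scaling is multiplicative, so it can be applied to both sides of the cleared
    geometric series. It turns e^(i d t) - 1 into \<open>E (i * j)\<close>.\<close>
  have S: "fps_scale (of_nat j) (char_exp_sum (i * d) f) * E j = A j * E (i * j)" for i j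
    using arg_cong[OF char_exp_sum_mult_period[of f d i, OF per], of "fps_scale (of_nat j)"]
    unfolding fps_scale_mult fps_scale_exp_minus_1 E_def A_def by (simp add: mult_ac)
  have B: "fps_scale (of_nat j) (gen_bernoulli_fps d f x) * E j =
      fps_const (of_nat j) * fps_X * fps_exp (of_nat j * x) * A j" for j x
    using arg_cong[OF gen_bernoulli_fps_mult[OF \<open>d > 0\<close>, of f x], of "fps_scale (of_nat j)"]
    unfolding fps_scale_mult fps_scale_exp_minus_1 fps_exp_compose_linear E_def A_def
      char_exp_sum_def[symmetric]
    by (simp add: mult_ac)
  have "triple_fps d f y u v w * (E (v * w) * E (u * w) * E (u * v)) =
      (fps_scale (of_nat (v * w)) (gen_bernoulli_fps d f (of_nat u * y)) * E (v * w)) *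
      (fps_scale (of_nat (u * w)) (char_exp_sum (v * d) f) * E (u * w)) *
      (fps_scale (of_nat (u * v)) (char_exp_sum (w * d) f) * E (u * v))"
    unfolding triple_fps_def by (simp only: mult_ac)
  \<comment> \<open>Both power sum factors yield the same numerator, as v (u w) = w (u v) = u v w;
    hence the square. The exponent of the exponential is (v w)(u y).\<close>
  also have "\<dots> = fps_const (of_nat (v * w)) * (fps_X * fps_exp (of_nat (u * v * w) * y) *
      E (u * v * w) ^ 2 * (A (v * w) * A (u * w) * A (u * v)))"
    unfolding S B power2_eq_square by (simp add: mult_ac)
  finally show ?thesis .
qed

lemma triple_sum_rotate:
  fixes f :: "int \<Rightarrow> 'c :: field_char_0"
  assumes pos: "d > 0" "u > 0" "v > 0" "w > 0" and per: "\<And>a. f (a + int d) = f a"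
  shows "triple_sum d f y n u v w = triple_sum d f y n v w u"
proof -
  define E where "E j = (fps_exp (of_nat (j * d)) - 1 :: 'c fps)" for j
  define D where "D = E (v * w) * E (u * w) * E (u * v)"
  have "E j \<noteq> 0" if "j > 0" for j
    unfolding E_def using that pos(1) by (intro fps_exp_minus_1_nonzero) simp
  then have "D \<noteq> 0" using pos by (simp add: D_def)
  \<comment> \<open>\<open>D\<close> is invariant under rotation. Cross-multiplying by the constant
    of the other side makes both sides the same symmetric series times \<open>v * w\<close> and
    \<open>w * u\<close>; then \<open>D\<close> cancels because power series over a field form an
    integral domain.\<close>
  have "fps_const (of_nat (w * u)) * triple_fps d f y u v w * D =
      fps_const (of_nat (v * w)) * triple_fps d f y v w u * D"
    using triple_fps_mult_denominators[of d f y u v w, OF pos(1) per]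
      triple_fps_mult_denominators[of d f y v w u, OF pos(1) per]
    unfolding D_def E_def by (simp add: mult_ac)
  with \<open>D \<noteq> 0\<close> have "fps_const (of_nat (w * u)) * triple_fps d f y u v w =
      fps_const (of_nat (v * w)) * triple_fps d f y v w u"
    by simp
  then have "of_nat (w * u) * fps_nth (triple_fps d f y u v w) n =
      of_nat (v * w) * fps_nth (triple_fps d f y v w u) n"
    by (metis fps_mult_left_const_nth)
  then show ?thesis
    using pos by (simp add: triple_sum_conv_fps_nth field_simps)
qed

theorem theorem4:
  fixes p d w\<^sub>1 w\<^sub>2 w\<^sub>3 n :: nat
    and v :: "'c :: field_char_0 \<Rightarrow> real"
    and \<iota> :: "complex \<Rightarrow> 'c"
    and \<chi> :: "int \<Rightarrow> complex"
    and y\<^sub>1 :: 'c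
  assumes "complex_padic_field p v"
    and "algebraic_embedding \<iota>"
    and "d > 0"
    and "primitive_dirichlet_character d \<chi>"
    and "w\<^sub>1 > 0" and "w\<^sub>2 > 0" and "w\<^sub>3 > 0"
    and "y\<^sub>1 \<in> Zp_in v"
  shows "(\<Sum>(k, l, m) \<in> {(k, l, m). k + l + m = n}.
            trinomial n k l m *
            gen_bernpoly d (\<iota> \<circ> \<chi>) k (of_nat w\<^sub>1 * y\<^sub>1) *
            gen_power_sum l (w\<^sub>2 * d - 1) (\<iota> \<circ> \<chi>) *
            gen_power_sum m (w\<^sub>3 * d - 1) (\<iota> \<circ> \<chi>) *
            of_nat w\<^sub>1 ^ (l + m) *
            of_nat w\<^sub>2 powi (int k + int m - 1) *
            of_nat w\<^sub>3 powi (int k + int l - 1))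
        =
         (\<Sum>(k, l, m) \<in> {(k, l, m). k + l + m = n}.
            trinomial n k l m *
            gen_bernpoly d (\<iota> \<circ> \<chi>) k (of_nat w\<^sub>2 * y\<^sub>1) *
            gen_power_sum l (w\<^sub>3 * d - 1) (\<iota> \<circ> \<chi>) *
            gen_power_sum m (w\<^sub>1 * d - 1) (\<iota> \<circ> \<chi>) *
            of_nat w\<^sub>2 ^ (l + m) *
            of_nat w\<^sub>3 powi (int k + int m - 1) *
            of_nat w\<^sub>1 powi (int k + int l - 1))
      \<and>
         (\<Sum>(k, l, m) \<in> {(k, l, m). k + l + m = n}.
            trinomial n k l m *
            gen_bernpoly d (\<iota> \<circ> \<chi>) k (of_nat w\<^sub>2 * y\<^sub>1) *
            gen_power_sum l (w\<^sub>3 * d - 1) (\<iota> \<circ> \<chi>) *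
            gen_power_sum m (w\<^sub>1 * d - 1) (\<iota> \<circ> \<chi>) *
            of_nat w\<^sub>2 ^ (l + m) *
            of_nat w\<^sub>3 powi (int k + int m - 1) *
            of_nat w\<^sub>1 powi (int k + int l - 1))
        =
         (\<Sum>(k, l, m) \<in> {(k, l, m). k + l + m = n}.
            trinomial n k l m *
            gen_bernpoly d (\<iota> \<circ> \<chi>) k (of_nat w\<^sub>3 * y\<^sub>1) *
            gen_power_sum l (w\<^sub>1 * d - 1) (\<iota> \<circ> \<chi>) *
            gen_power_sum m (w\<^sub>2 * d - 1) (\<iota> \<circ> \<chi>) *
            of_nat w\<^sub>3 ^ (l + m) *
            of_nat w\<^sub>1 powi (int k + int m - 1) *
            of_nat w\<^sub>2 powi (int k + int l - 1))"
proof -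
  have "(\<iota> \<circ> \<chi>) (a + int d) = (\<iota> \<circ> \<chi>) a" for a
  proof -
    have "[a + int d = a] (mod int d)" by (simp add: cong_def)
    with assms(4) show ?thesis
      unfolding primitive_dirichlet_character_def dirichlet_character_def comp_def by metis
  qed
  \<comment> \<open>The two equations are the rotations starting from (w1, w2, w3) and from (w2, w3,
    w1).\<close>
  note rotate = triple_sum_rotate[of d _ _ _ "\<iota> \<circ> \<chi>" y\<^sub>1 n, OF \<open>d > 0\<close> _ _ _ this,
      unfolded triple_sum_def]
  show ?thesis
    by (intro conjI rotate \<open>w\<^sub>1 > 0\<close> \<open>w\<^sub>2 > 0\<close> \<open>w\<^sub>3 > 0\<close>)
qed

end
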